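(* Let $(X, \delta\colon X \rightarrow (\mathcal{D}_{\omega}(X))^{A})$ be a GPS and $(\mathcal{D}_{\omega}(X), \langle o, t\rangle)$ be its associated determinisation. Then, for all $x \in X$, $w \in A^{*}$ and $\mathcal{I}\in\{\mathcal{T}_p,\mathcal{MT}_p\}$: $[\![\eta(x)]\!](w) = \mathcal{I}(x)(w)$.
   Context: A GPS is given by a probabilistic transition function $\mu\colon X\times A\times X\to[0,1]$ with $\sum_{a,y}\mu(x,a,y)\le 1$ for all $x$; write $\mu_a(x,y)=\mu(x,a,y)$, extended to words by $\mu_\varepsilon(x,y)=1$ if $x=y$ and $0$ otherwise, $\mu_{aw}(x,y)=\sum_{x'}\mu_a(x,x')\mu_w(x',y)$. The termination probability is $\mu_0(x,\mathbf{0})=1-\sum_{a,y}\mu(x,a,y)$. $\mathcal{D}_\omega(X)$ is the set of finitely supported subprobability distributions on $X$, $\eta(x)$ is the Dirac distribution at $x$, and the GPS is the coalgebra $\delta(x)(a)(y)=\mu_a(x,y)$. Decorations: $\overline{o}_{\mathcal{T}_p}(x)=1$ and $\overline{o}_{\mathcal{MT}_p}(x)=\mu_0(x,\mathbf{0})$, with values in $[0,1]$. The determinisation is the Moore automaton on $\mathcal{D}_\omega(X)$ with $o(\varphi)=\sum_{x\in supp(\varphi)}\varphi(x)\,\overline{o}_{\mathcal{I}}(x)$ and $t(\varphi)(a)(y)=\sum_{x\in supp(\varphi)}\delta(x)(a)(y)\,\varphi(x)$; $[\![-]\!]\colon\mathcal{D}_\omega(X)\to[0,1]^{A^*}$ is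 the unique map into the final Moore coalgebra, $[\![\varphi]\!](\varepsilon)=o(\varphi)$, $[\![\varphi]\!](aw)=[\![t(\varphi)(a)]\!](w)$. The trace function is $\mathcal{T}_p(x)(w)=\sum_{y\in X}\mu_w(x,y)$ and the maximal trace function is $\mathcal{MT}_p(x)(w)=\mu_{w0}(x,\mathbf{0})$, the probability of executing $w$ and then terminating. *)

theory Defs
  imports "HOL-Analysis.Analysis"
begin

typedef 'x subdist =
  "{\<phi> :: 'x \<Rightarrow> real. (\<forall>x. 0 \<le> \<phi> x) \<and> finite {x. \<phi> x \<noteq> 0} \<and> (\<Sum>x\<in>{x. \<phi> x \<noteq> 0}. \<phi> x) \<le> 1}"
  morphisms prob Abs_subdist
  by (rule exI[of _ "\<lambda>_. 0"]) simp

setup_lifting type_definition_subdist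

definition supp :: "'x subdist \<Rightarrow> 'x set" where
  "supp \<phi> = {x. prob \<phi> x \<noteq> 0}"

lift_definition \<eta> :: "'x \<Rightarrow> 'x subdist" is "\<lambda>x y. if x = y then 1 else 0"
  by simp

text \<open>State and action sets may be infinite, so the total outgoing mass is an unordered infinite
  sum. Summability is required explicitly, since \<^const>\<open>infsum\<close> is 0 on non-summable families.\<close>

definition gps :: "('x \<Rightarrow> 'a \<Rightarrow> 'x \<Rightarrow> real) \<Rightarrow> bool" where
  "gps \<mu> \<longleftrightarrow>
     (\<forall>x a y. 0 \<le> \<mu> x a y \<and> \<mu> x a y \<le> 1) \<and>
     (\<forall>x. (\<lambda>(a, y). \<mu> x a y) summable_on UNIV \<and> (\<Sum>\<^sub>\<infinity>(a, y)\<in>UNIV. \<mu> x a y) \<le> 1)"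

definition term_prob :: "('x \<Rightarrow> 'a \<Rightarrow> 'x \<Rightarrow> real) \<Rightarrow> 'x \<Rightarrow> real" where
  "term_prob \<mu> x = 1 - (\<Sum>\<^sub>\<infinity>(a, y)\<in>UNIV. \<mu> x a y)"

primrec word_prob :: "('x \<Rightarrow> 'a \<Rightarrow> 'x \<Rightarrow> real) \<Rightarrow> 'a list \<Rightarrow> 'x \<Rightarrow> 'x \<Rightarrow> real" where
  "word_prob \<mu> [] x y = (if x = y then 1 else 0)"
| "word_prob \<mu> (a # w) x y = (\<Sum>\<^sub>\<infinity>x'\<in>UNIV. \<mu> x a x' * word_prob \<mu> w x' y)"

text \<open>\<open>with_term \<mu>\<close> adjoins the termination action \<open>0\<close> and the terminated state \<open>\<zero>\<close>, both written
  \<^const>\<open>None\<close>. The state \<open>\<zero>\<close> is reached only by the action \<open>0\<close>, and nothing leaves it.\<close>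

fun with_term ::
  "('x \<Rightarrow> 'a \<Rightarrow> 'x \<Rightarrow> real) \<Rightarrow> 'x option \<Rightarrow> 'a option \<Rightarrow> 'x option \<Rightarrow> real" where
  "with_term \<mu> (Some x) (Some a) (Some y) = \<mu> x a y"
| "with_term \<mu> (Some x) None None = term_prob \<mu> x"
| "with_term \<mu> _ _ _ = 0"

definition trace_fn :: "('x \<Rightarrow> 'a \<Rightarrow> 'x \<Rightarrow> real) \<Rightarrow> 'x \<Rightarrow> 'a list \<Rightarrow> real" where
  "trace_fn \<mu> x w = (\<Sum>\<^sub>\<infinity>y\<in>UNIV. word_prob \<mu> w x y)"

definition max_trace_fn :: "('x \<Rightarrow> 'a \<Rightarrow> 'x \<Rightarrow> real) \<Rightarrow> 'x \<Rightarrow> 'a list \<Rightarrow> real" where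
  "max_trace_fn \<mu> x w = word_prob (with_term \<mu>) (map Some w @ [None]) (Some x) None"

datatype trace_sem = Trace | MaxTrace

fun sem_fn :: "trace_sem \<Rightarrow> ('x \<Rightarrow> 'a \<Rightarrow> 'x \<Rightarrow> real) \<Rightarrow> 'x \<Rightarrow> 'a list \<Rightarrow> real" where
  "sem_fn Trace = trace_fn"
| "sem_fn MaxTrace = max_trace_fn"

fun decoration :: "trace_sem \<Rightarrow> ('x \<Rightarrow> 'a \<Rightarrow> 'x \<Rightarrow> real) \<Rightarrow> 'x \<Rightarrow> real" where
  "decoration Trace \<mu> x = 1"
| "decoration MaxTrace \<mu> x = term_prob \<mu> x"

text \<open>The final Moore automaton over inputs \<open>'a\<close> and outputs \<open>'b\<close> has carrier \<open>'a list \<Rightarrow> 'b\<close>,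
  output \<open>L \<mapsto> L []\<close> and transitions \<open>L \<mapsto> (\<lambda>a w. L (a # w))\<close>.\<close>

definition final_hom ::
  "('s \<Rightarrow> 'b) \<Rightarrow> ('s \<Rightarrow> 'a \<Rightarrow> 's) \<Rightarrow> ('s \<Rightarrow> 'a list \<Rightarrow> 'b) \<Rightarrow> bool" where
  "final_hom out tr h \<longleftrightarrow>
     (\<forall>s. h s [] = out s) \<and> (\<forall>s a. (\<lambda>w. h s (a # w)) = h (tr s a))"

primrec moore_sem :: "('s \<Rightarrow> 'b) \<Rightarrow> ('s \<Rightarrow> 'a \<Rightarrow> 's) \<Rightarrow> 's \<Rightarrow> 'a list \<Rightarrow> 'b" where
  "moore_sem out tr s [] = out s"
| "moore_sem out tr s (a # w) = moore_sem out tr (tr s a) w"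

lemma final_hom_iff: "final_hom out tr h \<longleftrightarrow> h = moore_sem out tr"
proof
  assume h: "final_hom out tr h"
  have "h s w = moore_sem out tr s w" for s w
  proof (induction w arbitrary: s)
    case Nil
    then show ?case using h by (simp add: final_hom_def)
  next
    case (Cons a w)
    have "h s (a # w) = h (tr s a) w"
      using h by (simp add: final_hom_def fun_eq_iff)
    then show ?case using Cons by simp
  qed
  then show "h = moore_sem out tr" by blast
qed (auto simp: final_hom_def)

definition det_out :: "('x \<Rightarrow> real) \<Rightarrow> 'x subdist \<Rightarrow> real" where
  "det_out dec \<phi> = (\<Sum>x\<in>supp \<phi>. prob \<phi> x * dec x)"

lift_definition det_trans :: "('x \<Rightarrow> 'a \<Rightarrow> 'x subdist) \<Rightarrow> 'x subdist \<Rightarrow> 'a \<Rightarrow> 'x subdist" is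
  "\<lambda>\<delta> \<phi> a y. \<Sum>x\<in>{x. \<phi> x \<noteq> 0}. \<delta> x a y * \<phi> x"
proof -
  fix \<delta> :: "'x \<Rightarrow> 'a \<Rightarrow> 'x \<Rightarrow> real" and \<phi> :: "'x \<Rightarrow> real" and a :: 'a
  assume \<delta>: "\<And>x a. (\<forall>y. 0 \<le> \<delta> x a y) \<and> finite {y. \<delta> x a y \<noteq> 0} \<and> (\<Sum>y\<in>{y. \<delta> x a y \<noteq> 0}. \<delta> x a y) \<le> 1"
    and \<phi>: "(\<forall>x. 0 \<le> \<phi> x) \<and> finite {x. \<phi> x \<noteq> 0} \<and> (\<Sum>x\<in>{x. \<phi> x \<noteq> 0}. \<phi> x) \<le> 1"
  let ?S = "{x. \<phi> x \<noteq> 0}"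
  let ?t = "\<lambda>y. \<Sum>x\<in>?S. \<delta> x a y * \<phi> x"
  define T where "T = (\<Union>x\<in>?S. {y. \<delta> x a y \<noteq> 0})"
  have finT: "finite T" using \<delta> \<phi> by (auto simp: T_def)
  have sub: "{y. ?t y \<noteq> 0} \<subseteq> T"
  proof
    fix y assume "y \<in> {y. ?t y \<noteq> 0}"
    then obtain x where "x \<in> ?S" "\<delta> x a y * \<phi> x \<noteq> 0"
      using sum.not_neutral_contains_not_neutral[of "\<lambda>x. \<delta> x a y * \<phi> x" ?S] by auto
    then show "y \<in> T" by (auto simp: T_def)
  qed
  have mass: "(\<Sum>y\<in>T. \<delta> x a y) \<le> 1" if "x \<in> ?S" for x
  proof -
    have "(\<Sum>y\<in>T. \<delta> x a y) = (\<Sum>y\<in>{y. \<delta> x a y \<noteq> 0}. \<delta> x a y)"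
      by (rule sum.mono_neutral_right) (use finT that in \<open>auto simp: T_def\<close>)
    then show ?thesis using \<delta>[of x a] by simp
  qed
  have "(\<Sum>y\<in>{y. ?t y \<noteq> 0}. ?t y) = (\<Sum>y\<in>T. ?t y)"
    by (rule sum.mono_neutral_left) (use finT sub in auto)
  also have "\<dots> = (\<Sum>x\<in>?S. (\<Sum>y\<in>T. \<delta> x a y) * \<phi> x)"
    by (subst sum.swap) (simp add: sum_distrib_right)
  also have "\<dots> \<le> (\<Sum>x\<in>?S. 1 * \<phi> x)"
    by (intro sum_mono mult_right_mono mass) (use \<phi> in auto)
  also have "\<dots> \<le> 1" using \<phi> by simp
  finally have "(\<Sum>y\<in>{y. ?t y \<noteq> 0}. ?t y) \<le> 1" .
  moreover have "\<forall>y. 0 \<le> ?t y" using \<delta> \<phi> by (auto intro!: sum_nonneg)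
  moreover have "finite {y. ?t y \<noteq> 0}" using finT sub by (rule finite_subset[rotated])
  ultimately show "(\<forall>y. 0 \<le> ?t y) \<and> finite {y. ?t y \<noteq> 0} \<and> (\<Sum>y\<in>{y. ?t y \<noteq> 0}. ?t y) \<le> 1"
    by blast
qed

definition det_sem ::
  "('x \<Rightarrow> 'a \<Rightarrow> 'x subdist) \<Rightarrow> ('x \<Rightarrow> real) \<Rightarrow> 'x subdist \<Rightarrow> 'a list \<Rightarrow> real" where
  "det_sem \<delta> dec = moore_sem (det_out dec) (det_trans \<delta>)"

text \<open>Outputs are typed as reals; the following lemmas show that, for both decorations, the
  semantics takes its values in \<open>[0,1]\<close>.\<close>

lemma decoration_unit:
  assumes "gps \<mu>"
  shows "decoration I \<mu> x \<in> {0..1}"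
proof (cases I)
  case MaxTrace
  have "0 \<le> (\<Sum>\<^sub>\<infinity>(a, y)\<in>UNIV. \<mu> x a y)"
    by (rule infsum_nonneg) (use assms in \<open>auto simp: gps_def\<close>)
  then show ?thesis using assms MaxTrace by (simp add: gps_def term_prob_def)
qed simp

lemma det_out_unit:
  assumes "\<And>x. dec x \<in> {0..1}"
  shows "det_out dec \<phi> \<in> {0..1}"
proof -
  have p: "\<forall>x. 0 \<le> prob \<phi> x" "sum (prob \<phi>) (supp \<phi>) \<le> 1"
    using prob[of \<phi>] by (auto simp: supp_def)
  have "det_out dec \<phi> \<le> (\<Sum>x\<in>supp \<phi>. prob \<phi> x * 1)"
    unfolding det_out_def by (intro sum_mono mult_left_mono) (use assms p in auto)
  moreover have "0 \<le> det_out dec \<phi>"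
    unfolding det_out_def by (intro sum_nonneg mult_nonneg_nonneg) (use assms p in auto)
  ultimately show ?thesis using p by simp
qed

lemma det_sem_unit:
  assumes "gps \<mu>"
  shows "det_sem \<delta> (decoration I \<mu>) \<phi> w \<in> {0..1}"
proof (induction w arbitrary: \<phi>)
  case Nil
  show ?case
    using det_out_unit[of "decoration I \<mu>" \<phi>] decoration_unit[OF assms] by (simp add: det_sem_def)
next
  case (Cons a w)
  then show ?case by (simp add: det_sem_def)
qed

end

(* Both sides of the equation are linear in the current distribution, where det_out f phi serves as
   the expectation of f under phi. Hence the semantics of a state on a # w is the expectation, over
   its a-successors, of the semantics on w. The trace functions satisfy the same recursion, all sums
   there being finite because each delta x a has finite support. *)
theory Submission
  imports Defs
begin

lemma infsum_single:
  fixes f :: "'b \<Rightarrow> real"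
  assumes "\<And>y. y \<noteq> x \<Longrightarrow> f y = 0"
  shows "infsum f UNIV = f x"
proof -
  have "infsum f UNIV = infsum f {x}"
    by (rule infsum_cong_neutral) (use assms in auto)
  then show ?thesis by simp
qed

lemma infsum_sum:
  fixes f :: "'i \<Rightarrow> 'b \<Rightarrow> real"
  assumes "finite I" "\<And>i. i \<in> I \<Longrightarrow> f i summable_on A"
  shows "(\<Sum>\<^sub>\<infinity>y\<in>A. \<Sum>i\<in>I. f i y) = (\<Sum>i\<in>I. infsum (f i) A)"
proof -
  have "((\<lambda>y. \<Sum>i\<in>I. f i y) has_sum (\<Sum>i\<in>I. infsum (f i) A)) A"
    using assms by (induction I) (auto intro!: has_sum_add)
  then show ?thesis by (rule infsumI)
qed

lemma finite_supp: "finite (supp \<phi>)"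
  using prob[of \<phi>] by (simp add: supp_def)

text \<open>Allows distributions with different supports to be summed over one common finite index
  set.\<close>

lemma det_out_eq_sum:
  assumes "finite T" "supp \<phi> \<subseteq> T"
  shows "det_out f \<phi> = (\<Sum>x\<in>T. prob \<phi> x * f x)"
  unfolding det_out_def
  by (rule sum.mono_neutral_left) (use assms in \<open>auto simp: supp_def\<close>)

lemma det_out_eq_infsum: "det_out f \<phi> = (\<Sum>\<^sub>\<infinity>x\<in>UNIV. prob \<phi> x * f x)"
proof -
  have "(\<Sum>\<^sub>\<infinity>x\<in>UNIV. prob \<phi> x * f x) = (\<Sum>\<^sub>\<infinity>x\<in>supp \<phi>. prob \<phi> x * f x)"
    by (rule infsum_cong_neutral) (auto simp: supp_def)
  then show ?thesis by (simp add: det_out_def finite_supp)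
qed

lemma det_out_\<eta>: "det_out f (\<eta> x) = f x"
  by (subst det_out_eq_sum[of "{x}"]) (auto simp: supp_def \<eta>.rep_eq split: if_splits)

text \<open>The mass at a single point is itself an expectation, so facts about
  \<open>det_out\<close> carry over to \<open>det_trans\<close>.\<close>

lemma prob_det_trans: "prob (det_trans \<delta> \<phi> a) y = det_out (\<lambda>x. prob (\<delta> x a) y) \<phi>"
  by (simp add: det_trans.rep_eq det_out_def supp_def mult.commute)

lemma det_trans_\<eta>: "det_trans \<delta> (\<eta> x) a = \<delta> x a"
  by (simp add: prob_inject[symmetric] fun_eq_iff prob_det_trans det_out_\<eta>)

text \<open>The law of total expectation for one transition: two finite sums are exchanged. The set
  \<open>T\<close> collects all possible successors, which makes the inner index set independent of
  \<open>x\<close>.\<close>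

lemma det_out_det_trans:
  "det_out f (det_trans \<delta> \<phi> a) = det_out (\<lambda>x. det_out f (\<delta> x a)) \<phi>"
proof -
  define T where "T = (\<Union>x\<in>supp \<phi>. supp (\<delta> x a))"
  have fin: "finite T" by (simp add: T_def finite_supp)
  have "prob (det_trans \<delta> \<phi> a) y = 0" if "y \<notin> T" for y
    unfolding prob_det_trans det_out_def
    by (rule sum.neutral) (use that in \<open>auto simp: T_def supp_def\<close>)
  then have "supp (det_trans \<delta> \<phi> a) \<subseteq> T" by (auto simp: supp_def)
  then have "det_out f (det_trans \<delta> \<phi> a)
      = (\<Sum>y\<in>T. \<Sum>x\<in>supp \<phi>. prob \<phi> x * (prob (\<delta> x a) y * f y))"
    by (simp add: det_out_eq_sum[OF fin] prob_det_trans)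
       (simp add: det_out_def sum_distrib_right mult.assoc)
  also have "\<dots> = (\<Sum>x\<in>supp \<phi>. prob \<phi> x * (\<Sum>y\<in>T. prob (\<delta> x a) y * f y))"
    by (subst sum.swap) (simp add: sum_distrib_left)
  also have "\<dots> = (\<Sum>x\<in>supp \<phi>. prob \<phi> x * det_out f (\<delta> x a))"
    by (intro sum.cong refl) (subst det_out_eq_sum[OF fin], auto simp: T_def)
  finally show ?thesis by (simp add: det_out_def[of _ \<phi>])
qed

lemma det_sem_linear:
  "det_sem \<delta> dec \<phi> w = det_out (\<lambda>x. det_sem \<delta> dec (\<eta> x) w) \<phi>"
proof (induction w arbitrary: \<phi>)
  case Nil
  show ?case by (simp add: det_sem_def det_out_\<eta>)
next
  case (Cons a w)
  have step: "det_sem \<delta> dec \<psi> (a # w) = det_sem \<delta> dec (det_trans \<delta> \<psi> a) w" for \<psi>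
    by (simp add: det_sem_def)
  show ?case
    unfolding step det_trans_\<eta>
    \<comment> \<open>The hypothesis is used at \<open>det_trans \<delta> \<phi> a\<close> on the
      left and at \<open>\<delta> x a\<close> on the right. Its right-hand side contains instances
      of its left-hand side, so unrestricted rewriting would loop.\<close>
    by (subst (1 2) Cons.IH) (rule det_out_det_trans)
qed

lemma det_sem_\<eta>_Cons:
  "det_sem \<delta> dec (\<eta> x) (a # w) = det_out (\<lambda>y. det_sem \<delta> dec (\<eta> y) w) (\<delta> x a)"
  by (subst det_sem_linear[symmetric]) (simp add: det_sem_def det_trans_\<eta>)

context
  fixes \<mu> :: "'x \<Rightarrow> 'a \<Rightarrow> 'x \<Rightarrow> real" and \<delta> :: "'x \<Rightarrow> 'a \<Rightarrow> 'x subdist"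
  assumes prob_\<delta>: "\<And>x a y. prob (\<delta> x a) y = \<mu> x a y"
begin

lemma word_prob_Cons_det_out:
  "word_prob \<mu> (a # w) x y = det_out (\<lambda>x'. word_prob \<mu> w x' y) (\<delta> x a)"
  by (simp add: det_out_eq_infsum prob_\<delta>)

text \<open>By induction, the states reachable along \<open>a # w\<close> lie in a finite union of
  finite sets, one for each state in the support of \<open>\<delta> x a\<close>.\<close>

lemma finite_word_prob: "finite {y. word_prob \<mu> w x y \<noteq> 0}"
proof (induction w arbitrary: x)
  case Nil
  show ?case by simp
next
  case (Cons a w)
  have "word_prob \<mu> (a # w) x y = 0"
    if "y \<notin> (\<Union>x'\<in>supp (\<delta> x a). {y. word_prob \<mu> w x' y \<noteq> 0})" for y
    unfolding word_prob_Cons_det_out det_out_def using that by (intro sum.neutral) auto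
  then have "{y. word_prob \<mu> (a # w) x y \<noteq> 0}
      \<subseteq> (\<Union>x'\<in>supp (\<delta> x a). {y. word_prob \<mu> w x' y \<noteq> 0})" by blast
  then show ?case by (rule finite_subset) (simp add: finite_supp Cons)
qed

lemma word_prob_summable: "word_prob \<mu> w x summable_on UNIV"
proof -
  have "word_prob \<mu> w x summable_on {y. word_prob \<mu> w x y \<noteq> 0}"
    by (rule summable_on_finite) (rule finite_word_prob)
  then show ?thesis by (rule summable_on_cong_neutral[THEN iffD1, rotated -1]) auto
qed

text \<open>The finite sum over first successors moves outside the sum over end states; this
  exchange rests on \<open>word_prob_summable\<close>.\<close>

lemma trace_fn_Cons: "trace_fn \<mu> x (a # w) = det_out (\<lambda>y. trace_fn \<mu> y w) (\<delta> x a)"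
proof -
  have "trace_fn \<mu> x (a # w)
      = (\<Sum>\<^sub>\<infinity>y\<in>UNIV. \<Sum>x'\<in>supp (\<delta> x a). prob (\<delta> x a) x' * word_prob \<mu> w x' y)"
    unfolding trace_fn_def word_prob_Cons_det_out det_out_def ..
  also have "\<dots> = (\<Sum>x'\<in>supp (\<delta> x a). \<Sum>\<^sub>\<infinity>y\<in>UNIV. prob (\<delta> x a) x' * word_prob \<mu> w x' y)"
    by (intro infsum_sum finite_supp summable_on_cmult_right word_prob_summable)
  also have "\<dots> = det_out (\<lambda>y. trace_fn \<mu> y w) (\<delta> x a)"
    unfolding det_out_def trace_fn_def
    by (intro sum.cong refl infsum_cmult_right word_prob_summable)
  finally show ?thesis .
qed

lemma max_trace_fn_Cons:
  "max_trace_fn \<mu> x (a # w) = det_out (\<lambda>y. max_trace_fn \<mu> y w) (\<delta> x a)"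
proof -
  let ?f = "\<lambda>z. with_term \<mu> (Some x) (Some a) z
    * word_prob (with_term \<mu>) (map Some w @ [None]) z None"
  \<comment> \<open>A proper action never leads to the terminated state, so the term at
    \<open>None\<close> vanishes.\<close>
  have "infsum ?f UNIV = infsum ?f (range Some)"
    by (rule infsum_cong_neutral) (auto simp: notin_range_Some)
  also have "\<dots> = infsum (?f \<circ> Some) UNIV"
    by (rule infsum_reindex) simp
  finally show ?thesis
    by (simp add: max_trace_fn_def det_out_eq_infsum prob_\<delta> o_def)
qed

lemma sem_fn_Cons: "sem_fn I \<mu> x (a # w) = det_out (\<lambda>y. sem_fn I \<mu> y w) (\<delta> x a)"
  by (cases I) (simp_all add: trace_fn_Cons max_trace_fn_Cons)

end

text \<open>Each sum has a single nonzero candidate: the end state \<open>x\<close> for traces, and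
  the terminated state, reached with weight \<open>term_prob \<mu> x\<close>, for maximal
  traces.\<close>

lemma sem_fn_Nil: "sem_fn I \<mu> x [] = decoration I \<mu> x"
proof (cases I)
  case Trace
  then show ?thesis by (simp add: trace_fn_def infsum_single[of x])
next
  case MaxTrace
  then show ?thesis by (simp add: max_trace_fn_def infsum_single[of None])
qed

theorem theorem4p6:
  fixes \<mu> :: "'x \<Rightarrow> 'a \<Rightarrow> 'x \<Rightarrow> real"
    and \<delta> :: "'x \<Rightarrow> 'a \<Rightarrow> 'x subdist"
  assumes "gps \<mu>"
    and "\<And>x a y. prob (\<delta> x a) y = \<mu> x a y"
  shows "\<forall>x w. \<forall>I \<in> {Trace, MaxTrace}.
           det_sem \<delta> (decoration I \<mu>) (\<eta> x) w = sem_fn I \<mu> x w"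
proof -
  have "det_sem \<delta> (decoration I \<mu>) (\<eta> x) w = sem_fn I \<mu> x w" for I x w
  proof (induction w arbitrary: x)
    case Nil
    show ?case by (simp add: det_sem_def det_out_\<eta> sem_fn_Nil)
  next
    case (Cons a w)
    \<comment> \<open>Both recursions take an expectation under the same
      \<open>\<delta> x a\<close>, so the hypothesis, general in the state, identifies the
      integrands.\<close>
    show ?case by (simp only: det_sem_\<eta>_Cons sem_fn_Cons[OF assms(2)] Cons.IH)
  qed
  then show ?thesis by blast
qed

end
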